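(* Let $n\ge 1$ and let $(M^{2n+1},\phi,\zeta,\eta,g)$ be a para-cosymplectic manifold. Suppose $M$ admits a proper $h$-almost Ricci-Yamabe soliton $(g,\zeta,\lambda,\alpha,\beta)$ with soliton vector field $\zeta$, i.e. there are smooth functions $h,\lambda:M\to\mathbb{R}$ and constants $\alpha,\beta\in\mathbb{R}$ with $\alpha\neq 0,1$ such that $$\frac{h}{2}\pounds_\zeta g+\alpha S+\Big(\lambda-\frac{\beta}{2}r\Big)g=0 .$$ Then $M$ is an Einstein manifold.
   Context: All objects are smooth. $\nabla$ is the Levi-Civita connection of the semi-Riemannian metric $g$, $R(X,Y)Z=\nabla_X\nabla_YZ-\nabla_Y\nabla_XZ-\nabla_{[X,Y]}Z$, $S(Y,Z)=\mathrm{tr}(X\mapsto R(X,Y)Z)$ is the Ricci tensor, $r$ the scalar curvature, $\pounds$ the Lie derivative. Einstein means $S=c\,g$ for a constant $c$. Almost paracontact metric manifold $(M^{2n+1},\phi,\zeta,\eta,g)$: $\phi$ is a $(1,1)$-tensor field, $\zeta$ a vector field, $\eta$ a 1-form, with $\phi^2=I-\eta\otimes\zeta$, $\eta(\zeta)=1$, the $\pm1$-eigendistributions of $\phi$ on $\ker\eta$ both have dimension $n$, and $g$ is a semi-Riemannian metric with $g(\phi X,\phi Y)=-g(X,Y)+\eta(X)\eta(Y)$. It follows that $\phi\zeta=0$, $\eta\circ\phi=0$, $\eta=g(\cdot,\zeta)$. The fundamental 2-form is $\Phi(X,Y)=g(X,\phi Y)$. Normal: the tensor $[\phi,\phi]-2d\eta\otimes\zeta$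 vanishes, where $[\phi,\phi]$ is the Nijenhuis torsion of $\phi$ and $2d\eta(X,Y)=X\eta(Y)-Y\eta(X)-\eta([X,Y])$. Para-cosymplectic manifold: a normal almost paracontact metric manifold with $d\eta=0$ and $d\Phi=0$. Such a manifold satisfies $\nabla\phi=0$, $\nabla\zeta=0$, $R(X,Y)\zeta=0$ and $S(X,\zeta)=0$. *)

theory Defs
  imports "HOL-Analysis.Analysis" "HOL-Library.Function_Algebras"
begin

subsection \<open>The pointwise real vector space of functions\<close>

instantiation "fun" :: (type, scaleR) scaleR
begin

definition scaleR_fun :: "real \<Rightarrow> ('a \<Rightarrow> 'b) \<Rightarrow> 'a \<Rightarrow> 'b" where
  "scaleR_fun r f = (\<lambda>x. r *\<^sub>R f x)"

instance ..

end

lemma scaleR_fun_apply [simp]: "(r *\<^sub>R f) x = r *\<^sub>R f x"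
  by (simp add: scaleR_fun_def)

instance "fun" :: (type, real_vector) real_vector
  by standard (simp_all add: fun_eq_iff scaleR_add_right scaleR_add_left)

subsection \<open>Smooth manifolds and smooth functions\<close>

primrec Ck_on ::
    "nat \<Rightarrow> 'e::real_normed_vector set \<Rightarrow> ('e \<Rightarrow> 'b::real_normed_vector) \<Rightarrow> bool" where
  "Ck_on 0 S f \<longleftrightarrow> continuous_on S f"
| "Ck_on (Suc k) S f \<longleftrightarrow>
     (\<forall>x\<in>S. f differentiable (at x)) \<and>
     (\<forall>v. Ck_on k S (\<lambda>x. frechet_derivative f (at x) v))"

text \<open>Only used for open \<open>S\<close>.\<close>

definition smooth_on ::
    "'e::real_normed_vector set \<Rightarrow> ('e \<Rightarrow> 'b::real_normed_vector) \<Rightarrow> bool" where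
  "smooth_on S f \<longleftrightarrow> (\<forall>k. Ck_on k S f)"

text \<open>A chart is a pair of its domain and its coordinate map; the values of the coordinate map
  off the domain are irrelevant. The manifold is the whole point type, and an atlas need not be
  maximal: the smooth functions below depend only on the maximal atlas it generates.\<close>

type_synonym ('a, 'e) chart = "'a set \<times> ('a \<Rightarrow> 'e)"

definition smooth_atlas ::
    "('a::{t2_space,second_countable_topology}, 'e::euclidean_space) chart set \<Rightarrow> bool" where
  "smooth_atlas A \<longleftrightarrow>
     (\<Union>(U, c)\<in>A. U) = UNIV \<and>
     (\<forall>(U, c)\<in>A. open U \<and> open (c ` U) \<and> homeomorphism U (c ` U) c (inv_into U c)) \<and>
     (\<forall>(U, c)\<in>A. \<forall>(V, d)\<in>A. smooth_on (c ` (U \<inter> V)) (d \<circ> inv_into U c))"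

definition smooth_fns ::
    "('a::topological_space, 'e::euclidean_space) chart set \<Rightarrow> ('a \<Rightarrow> real) set" where
  "smooth_fns A = {f. \<forall>(U, c)\<in>A. smooth_on (c ` U) (f \<circ> inv_into U c)}"

subsection \<open>Tangent vectors and vector fields\<close>

type_synonym 'a tvec = "('a \<Rightarrow> real) \<Rightarrow> real"
type_synonym 'a vfield = "'a \<Rightarrow> 'a tvec"

text \<open>Tangent vectors at \<open>p\<close> are the derivations at \<open>p\<close> of the algebra of smooth functions. They are
  set to \<open>0\<close> on non-smooth functions, so that two tangent vectors are equal as soon as
  they agree on all smooth functions.\<close>

definition tangent_space ::
    "('a::topological_space, 'e::euclidean_space) chart set \<Rightarrow> 'a \<Rightarrow> 'a tvec set" where
  "tangent_space A p = {D.
     (\<forall>f. f \<notin> smooth_fns A \<longrightarrow> D f = 0) \<and>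
     (\<forall>f\<in>smooth_fns A. \<forall>g\<in>smooth_fns A. D (\<lambda>q. f q + g q) = D f + D g) \<and>
     (\<forall>f\<in>smooth_fns A. \<forall>a. D (\<lambda>q. a * f q) = a * D f) \<and>
     (\<forall>f\<in>smooth_fns A. \<forall>g\<in>smooth_fns A. D (\<lambda>q. f q * g q) = D f * g p + f p * D g)}"

definition vfields ::
    "('a::topological_space, 'e::euclidean_space) chart set \<Rightarrow> 'a vfield set" where
  "vfields A = {X. (\<forall>p. X p \<in> tangent_space A p) \<and>
                   (\<forall>f\<in>smooth_fns A. (\<lambda>p. X p f) \<in> smooth_fns A)}"

definition fmul :: "('a \<Rightarrow> real) \<Rightarrow> 'a vfield \<Rightarrow> 'a vfield" where
  "fmul f X = (\<lambda>p. f p *\<^sub>R X p)"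

definition lie_bracket :: "'a vfield \<Rightarrow> 'a vfield \<Rightarrow> 'a vfield" where
  "lie_bracket X Y = (\<lambda>p f. X p (\<lambda>q. Y q f) - Y p (\<lambda>q. X q f))"

definition extension ::
    "('a::topological_space, 'e::euclidean_space) chart set \<Rightarrow> 'a \<Rightarrow> 'a tvec \<Rightarrow> 'a vfield" where
  "extension A p v = (SOME X. X \<in> vfields A \<and> X p = v)"

subsection \<open>Tensor fields\<close>

text \<open>Tensor fields are families of multilinear maps on the tangent spaces which send smooth vector
  fields to smooth objects. Their values on arguments that are not tangent vectors at the given
  point are irrelevant.\<close>

definition linear_over :: "'v::real_vector set \<Rightarrow> ('v \<Rightarrow> 'w::real_vector) \<Rightarrow> bool" where
  "linear_over V T \<longleftrightarrow>
     (\<forall>u\<in>V. \<forall>v\<in>V. T (u + v) = T u + T v) \<and> (\<forall>a. \<forall>v\<in>V. T (a *\<^sub>R v) = a *\<^sub>R T v)"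

definition one_form ::
    "('a::topological_space, 'e::euclidean_space) chart set \<Rightarrow> ('a \<Rightarrow> 'a tvec \<Rightarrow> real) \<Rightarrow> bool" where
  "one_form A \<eta> \<longleftrightarrow>
     (\<forall>p. linear_over (tangent_space A p) (\<eta> p)) \<and>
     (\<forall>X\<in>vfields A. (\<lambda>p. \<eta> p (X p)) \<in> smooth_fns A)"

definition endo_field ::
    "('a::topological_space, 'e::euclidean_space) chart set \<Rightarrow> ('a \<Rightarrow> 'a tvec \<Rightarrow> 'a tvec) \<Rightarrow> bool" where
  "endo_field A \<phi> \<longleftrightarrow>
     (\<forall>p. \<phi> p ` tangent_space A p \<subseteq> tangent_space A p \<and> linear_over (tangent_space A p) (\<phi> p)) \<and>
     (\<forall>X\<in>vfields A. (\<lambda>p. \<phi> p (X p)) \<in> vfields A)"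

definition bilinear_field ::
    "('a::topological_space, 'e::euclidean_space) chart set \<Rightarrow> ('a \<Rightarrow> 'a tvec \<Rightarrow> 'a tvec \<Rightarrow> real) \<Rightarrow> bool" where
  "bilinear_field A g \<longleftrightarrow>
     (\<forall>p. \<forall>u\<in>tangent_space A p.
        linear_over (tangent_space A p) (g p u) \<and>
        linear_over (tangent_space A p) (\<lambda>v. g p v u)) \<and>
     (\<forall>X\<in>vfields A. \<forall>Y\<in>vfields A. (\<lambda>p. g p (X p) (Y p)) \<in> smooth_fns A)"

definition form_index :: "'v::real_vector set \<Rightarrow> ('v \<Rightarrow> 'v \<Rightarrow> real) \<Rightarrow> nat" where
  "form_index V b = (GREATEST k. \<exists>W. subspace W \<and> W \<subseteq> V \<and> dim W = k \<and>
                                   (\<forall>w\<in>W. w \<noteq> 0 \<longrightarrow> b w w < 0))"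

definition semi_riemannian_metric ::
    "('a::topological_space, 'e::euclidean_space) chart set \<Rightarrow> ('a \<Rightarrow> 'a tvec \<Rightarrow> 'a tvec \<Rightarrow> real) \<Rightarrow> bool" where
  "semi_riemannian_metric A g \<longleftrightarrow>
     bilinear_field A g \<and>
     (\<forall>p. \<forall>u\<in>tangent_space A p. \<forall>v\<in>tangent_space A p. g p u v = g p v u) \<and>
     (\<forall>p. \<forall>u\<in>tangent_space A p. (\<forall>v\<in>tangent_space A p. g p u v = 0) \<longrightarrow> u = 0) \<and>
     (\<exists>\<nu>. \<forall>p. form_index (tangent_space A p) (g p) = \<nu>)"

text \<open>Exterior derivatives carry the factor \<open>1/(k+1)\<close>, as in
  \<open>2 d\<eta>(X,Y) = X \<eta>(Y) - Y \<eta>(X) - \<eta>([X,Y])\<close>.\<close>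

definition d_one_form ::
    "('a \<Rightarrow> 'a tvec \<Rightarrow> real) \<Rightarrow> 'a vfield \<Rightarrow> 'a vfield \<Rightarrow> 'a \<Rightarrow> real" where
  "d_one_form \<eta> X Y p =
     (X p (\<lambda>q. \<eta> q (Y q)) - Y p (\<lambda>q. \<eta> q (X q)) - \<eta> p (lie_bracket X Y p)) / 2"

definition d_two_form ::
    "('a \<Rightarrow> 'a tvec \<Rightarrow> 'a tvec \<Rightarrow> real) \<Rightarrow> 'a vfield \<Rightarrow> 'a vfield \<Rightarrow> 'a vfield \<Rightarrow> 'a \<Rightarrow> real" where
  "d_two_form \<omega> X Y Z p =
     (X p (\<lambda>q. \<omega> q (Y q) (Z q)) + Y p (\<lambda>q. \<omega> q (Z q) (X q)) + Z p (\<lambda>q. \<omega> q (X q) (Y q))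
      - \<omega> p (lie_bracket X Y p) (Z p) - \<omega> p (lie_bracket Y Z p) (X p)
      - \<omega> p (lie_bracket Z X p) (Y p)) / 3"

definition nijenhuis ::
    "('a \<Rightarrow> 'a tvec \<Rightarrow> 'a tvec) \<Rightarrow> 'a vfield \<Rightarrow> 'a vfield \<Rightarrow> 'a vfield" where
  "nijenhuis \<phi> X Y p =
     \<phi> p (\<phi> p (lie_bracket X Y p)) + lie_bracket (\<lambda>q. \<phi> q (X q)) (\<lambda>q. \<phi> q (Y q)) p
     - \<phi> p (lie_bracket (\<lambda>q. \<phi> q (X q)) Y p) - \<phi> p (lie_bracket X (\<lambda>q. \<phi> q (Y q)) p)"

text \<open>The Lie derivative of a field of bilinear forms.\<close>

definition lie_derivative ::
    "'a vfield \<Rightarrow> ('a \<Rightarrow> 'a tvec \<Rightarrow> 'a tvec \<Rightarrow> real) \<Rightarrow> 'a vfield \<Rightarrow> 'a vfield \<Rightarrow> 'a \<Rightarrow> real" where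
  "lie_derivative V g X Y p =
     V p (\<lambda>q. g q (X q) (Y q)) - g p (lie_bracket V X p) (Y p) - g p (X p) (lie_bracket V Y p)"

subsection \<open>Levi-Civita connection and curvature\<close>

definition affine_connection ::
    "('a::topological_space, 'e::euclidean_space) chart set \<Rightarrow>
     ('a vfield \<Rightarrow> 'a vfield \<Rightarrow> 'a vfield) \<Rightarrow> bool" where
  "affine_connection A nabla \<longleftrightarrow>
     (\<forall>X\<in>vfields A. \<forall>Y\<in>vfields A. nabla X Y \<in> vfields A) \<and>
     (\<forall>X\<in>vfields A. \<forall>X'\<in>vfields A. \<forall>Y\<in>vfields A. nabla (X + X') Y = nabla X Y + nabla X' Y) \<and>
     (\<forall>f\<in>smooth_fns A. \<forall>X\<in>vfields A. \<forall>Y\<in>vfields A. nabla (fmul f X) Y = fmul f (nabla X Y)) \<and>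
     (\<forall>X\<in>vfields A. \<forall>Y\<in>vfields A. \<forall>Y'\<in>vfields A. nabla X (Y + Y') = nabla X Y + nabla X Y') \<and>
     (\<forall>f\<in>smooth_fns A. \<forall>X\<in>vfields A. \<forall>Y\<in>vfields A.
        nabla X (fmul f Y) = fmul (\<lambda>p. X p f) Y + fmul f (nabla X Y))"

definition levi_civita ::
    "('a::topological_space, 'e::euclidean_space) chart set \<Rightarrow> ('a \<Rightarrow> 'a tvec \<Rightarrow> 'a tvec \<Rightarrow> real) \<Rightarrow>
     ('a vfield \<Rightarrow> 'a vfield \<Rightarrow> 'a vfield) \<Rightarrow> bool" where
  "levi_civita A g nabla \<longleftrightarrow>
     affine_connection A nabla \<and>
     (\<forall>X\<in>vfields A. \<forall>Y\<in>vfields A. nabla X Y - nabla Y X = lie_bracket X Y) \<and>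
     (\<forall>X\<in>vfields A. \<forall>Y\<in>vfields A. \<forall>Z\<in>vfields A. \<forall>p.
        X p (\<lambda>q. g q (Y q) (Z q)) = g p (nabla X Y p) (Z p) + g p (Y p) (nabla X Z p))"

definition curvature ::
    "('a vfield \<Rightarrow> 'a vfield \<Rightarrow> 'a vfield) \<Rightarrow> 'a vfield \<Rightarrow> 'a vfield \<Rightarrow> 'a vfield \<Rightarrow> 'a vfield" where
  "curvature nabla X Y Z =
     nabla X (nabla Y Z) - nabla Y (nabla X Z) - nabla (lie_bracket X Y) Z"

text \<open>The trace of an endomorphism of a finite-dimensional subspace, computed in some basis.\<close>

definition trace_on :: "'v::real_vector set \<Rightarrow> ('v \<Rightarrow> 'v) \<Rightarrow> real" where
  "trace_on V T = (let B = (SOME B. B \<subseteq> V \<and> independent B \<and> V \<subseteq> span B)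
                   in \<Sum>b\<in>B. representation B (T b) b)"

text \<open>\<open>S(Y,Z) = tr (X \<mapsto> R(X,Y)Z)\<close>. Curvature takes vector fields, so tangent vectors are
  extended to vector fields; as \<open>R\<close> is tensorial, the extension does not matter.\<close>

definition ricci ::
    "('a::topological_space, 'e::euclidean_space) chart set \<Rightarrow>
     ('a vfield \<Rightarrow> 'a vfield \<Rightarrow> 'a vfield) \<Rightarrow> 'a vfield \<Rightarrow> 'a vfield \<Rightarrow> 'a \<Rightarrow> real" where
  "ricci A nabla Y Z p =
     trace_on (tangent_space A p) (\<lambda>x. curvature nabla (extension A p x) Y Z p)"

definition ricci_operator ::
    "('a::topological_space, 'e::euclidean_space) chart set \<Rightarrow> ('a \<Rightarrow> 'a tvec \<Rightarrow> 'a tvec \<Rightarrow> real) \<Rightarrow>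
     ('a vfield \<Rightarrow> 'a vfield \<Rightarrow> 'a vfield) \<Rightarrow> 'a \<Rightarrow> 'a tvec \<Rightarrow> 'a tvec" where
  "ricci_operator A g nabla p y = (THE w. w \<in> tangent_space A p \<and>
     (\<forall>z\<in>tangent_space A p. g p w z = ricci A nabla (extension A p y) (extension A p z) p))"

definition scalar_curvature ::
    "('a::topological_space, 'e::euclidean_space) chart set \<Rightarrow> ('a \<Rightarrow> 'a tvec \<Rightarrow> 'a tvec \<Rightarrow> real) \<Rightarrow>
     ('a vfield \<Rightarrow> 'a vfield \<Rightarrow> 'a vfield) \<Rightarrow> 'a \<Rightarrow> real" where
  "scalar_curvature A g nabla p = trace_on (tangent_space A p) (ricci_operator A g nabla p)"

definition einstein ::
    "('a::topological_space, 'e::euclidean_space) chart set \<Rightarrow> ('a \<Rightarrow> 'a tvec \<Rightarrow> 'a tvec \<Rightarrow> real) \<Rightarrow>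
     ('a vfield \<Rightarrow> 'a vfield \<Rightarrow> 'a vfield) \<Rightarrow> bool" where
  "einstein A g nabla \<longleftrightarrow>
     (\<exists>c. \<forall>X\<in>vfields A. \<forall>Y\<in>vfields A. \<forall>p. ricci A nabla X Y p = c * g p (X p) (Y p))"

subsection \<open>Para-cosymplectic manifolds and Ricci-Yamabe solitons\<close>

definition almost_paracontact_metric ::
    "('a::{t2_space,second_countable_topology}, 'e::euclidean_space) chart set \<Rightarrow> nat \<Rightarrow>
     ('a \<Rightarrow> 'a tvec \<Rightarrow> 'a tvec) \<Rightarrow> 'a vfield \<Rightarrow> ('a \<Rightarrow> 'a tvec \<Rightarrow> real) \<Rightarrow>
     ('a \<Rightarrow> 'a tvec \<Rightarrow> 'a tvec \<Rightarrow> real) \<Rightarrow> bool" where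
  "almost_paracontact_metric A n \<phi> \<zeta> \<eta> g \<longleftrightarrow>
     smooth_atlas A \<and> DIM('e) = 2 * n + 1 \<and>
     endo_field A \<phi> \<and> \<zeta> \<in> vfields A \<and> one_form A \<eta> \<and> semi_riemannian_metric A g \<and>
     (\<forall>p. \<forall>v\<in>tangent_space A p. \<phi> p (\<phi> p v) = v - \<eta> p v *\<^sub>R \<zeta> p) \<and>
     (\<forall>p. \<eta> p (\<zeta> p) = 1) \<and>
     (\<forall>p. dim {v \<in> tangent_space A p. \<eta> p v = 0 \<and> \<phi> p v = v} = n \<and>
          dim {v \<in> tangent_space A p. \<eta> p v = 0 \<and> \<phi> p v = - v} = n) \<and>
     (\<forall>p. \<forall>u\<in>tangent_space A p. \<forall>v\<in>tangent_space A p.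
        g p (\<phi> p u) (\<phi> p v) = - g p u v + \<eta> p u * \<eta> p v)"

definition normal_structure ::
    "('a::topological_space, 'e::euclidean_space) chart set \<Rightarrow>
     ('a \<Rightarrow> 'a tvec \<Rightarrow> 'a tvec) \<Rightarrow> 'a vfield \<Rightarrow> ('a \<Rightarrow> 'a tvec \<Rightarrow> real) \<Rightarrow> bool" where
  "normal_structure A \<phi> \<zeta> \<eta> \<longleftrightarrow>
     (\<forall>X\<in>vfields A. \<forall>Y\<in>vfields A. \<forall>p.
        nijenhuis \<phi> X Y p - (2 * d_one_form \<eta> X Y p) *\<^sub>R \<zeta> p = 0)"

definition fundamental_form ::
    "('a \<Rightarrow> 'a tvec \<Rightarrow> 'a tvec) \<Rightarrow> ('a \<Rightarrow> 'a tvec \<Rightarrow> 'a tvec \<Rightarrow> real) \<Rightarrow>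
     'a \<Rightarrow> 'a tvec \<Rightarrow> 'a tvec \<Rightarrow> real" where
  "fundamental_form \<phi> g p u v = g p u (\<phi> p v)"

definition para_cosymplectic ::
    "('a::{t2_space,second_countable_topology}, 'e::euclidean_space) chart set \<Rightarrow> nat \<Rightarrow>
     ('a \<Rightarrow> 'a tvec \<Rightarrow> 'a tvec) \<Rightarrow> 'a vfield \<Rightarrow> ('a \<Rightarrow> 'a tvec \<Rightarrow> real) \<Rightarrow>
     ('a \<Rightarrow> 'a tvec \<Rightarrow> 'a tvec \<Rightarrow> real) \<Rightarrow> bool" where
  "para_cosymplectic A n \<phi> \<zeta> \<eta> g \<longleftrightarrow>
     almost_paracontact_metric A n \<phi> \<zeta> \<eta> g \<and>
     normal_structure A \<phi> \<zeta> \<eta> \<and>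
     (\<forall>X\<in>vfields A. \<forall>Y\<in>vfields A. \<forall>p. d_one_form \<eta> X Y p = 0) \<and>
     (\<forall>X\<in>vfields A. \<forall>Y\<in>vfields A. \<forall>Z\<in>vfields A. \<forall>p.
        d_two_form (fundamental_form \<phi> g) X Y Z p = 0)"

definition h_almost_ricci_yamabe_soliton ::
    "('a::topological_space, 'e::euclidean_space) chart set \<Rightarrow>
     ('a vfield \<Rightarrow> 'a vfield \<Rightarrow> 'a vfield) \<Rightarrow> ('a \<Rightarrow> real) \<Rightarrow>
     ('a \<Rightarrow> 'a tvec \<Rightarrow> 'a tvec \<Rightarrow> real) \<Rightarrow> 'a vfield \<Rightarrow> ('a \<Rightarrow> real) \<Rightarrow> real \<Rightarrow> real \<Rightarrow> bool" where
  "h_almost_ricci_yamabe_soliton A nabla h g V lam \<alpha> \<beta> \<longleftrightarrow>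
     h \<in> smooth_fns A \<and> lam \<in> smooth_fns A \<and> V \<in> vfields A \<and>
     (\<forall>X\<in>vfields A. \<forall>Y\<in>vfields A. \<forall>p.
        h p / 2 * lie_derivative V g X Y p + \<alpha> * ricci A nabla X Y p
        + (lam p - \<beta> / 2 * scalar_curvature A g nabla p) * g p (X p) (Y p) = 0)"

definition proper_h_almost_ricci_yamabe_soliton ::
    "('a::topological_space, 'e::euclidean_space) chart set \<Rightarrow>
     ('a vfield \<Rightarrow> 'a vfield \<Rightarrow> 'a vfield) \<Rightarrow> ('a \<Rightarrow> real) \<Rightarrow>
     ('a \<Rightarrow> 'a tvec \<Rightarrow> 'a tvec \<Rightarrow> real) \<Rightarrow> 'a vfield \<Rightarrow> ('a \<Rightarrow> real) \<Rightarrow> real \<Rightarrow> real \<Rightarrow> bool" where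
  "proper_h_almost_ricci_yamabe_soliton A nabla h g V lam \<alpha> \<beta> \<longleftrightarrow>
     h_almost_ricci_yamabe_soliton A nabla h g V lam \<alpha> \<beta> \<and> \<alpha> \<noteq> 0 \<and> \<alpha> \<noteq> 1"

end

theory Submission
  imports Defs "HOL-Real_Asymp.Real_Asymp"
begin

text \<open>Normality and \<open>d\<eta> = 0\<close> give \<open>[\<zeta>, \<phi> X] = \<phi> [\<zeta>, X]\<close>, and \<open>d\<Phi>(\<zeta>, X, Y) = 0\<close> then gives
  \<open>(L\<^sub>\<zeta> g)(X, \<phi> Y) = 0\<close>. As \<open>d\<eta> = 0\<close> also makes \<open>g(\<nabla>\<^sub>X \<zeta>, Y)\<close> symmetric in \<open>X\<close> and \<open>Y\<close>, this forces
  \<open>\<nabla>\<zeta> = 0\<close>, hence \<open>L\<^sub>\<zeta> g = 0\<close> and \<open>S(\<zeta>, \<zeta>) = 0\<close>. The soliton equation at \<open>(\<zeta>, \<zeta>)\<close> yields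
  \<open>\<lambda> - \<beta> r / 2 = 0\<close>, so it reduces to \<open>\<alpha> S = 0\<close>.

  Tangent vectors are abstract derivations, so passing between vectors and vector fields needs an
  extension result. Cut-off coordinate fields provide \<open>dim M\<close> linearly independent values at \<open>p\<close>,
  while the paracontact structure itself bounds the dimension of the tangent space by \<open>2 n + 1\<close>;
  hence these values span, and no Taylor expansion of smooth functions is needed.\<close>

subsection \<open>Functions of class \<open>C\<^sup>k\<close>\<close>

text \<open>On an open set, agreement on \<open>S\<close> is agreement near each of its points, so
  the Frechet derivatives agree on \<open>S\<close> as well, whatever the functions do
  elsewhere.\<close>

lemma Ck_on_cong:
  assumes "open S" "\<And>x. x \<in> S \<Longrightarrow> f x = g x" "Ck_on k S f"
  shows "Ck_on k S g"
  using assms(2,3)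
proof (induction k arbitrary: f g)
  case 0
  then show ?case by (simp cong: continuous_on_cong)
next
  case (Suc k)
  have der: "(g has_derivative frechet_derivative f (at x)) (at x)" if "x \<in> S" for x
    using has_derivative_transform_within_open[OF _ \<open>open S\<close> that Suc.prems(1)] Suc.prems(2) that
    by (auto simp: frechet_derivative_works)
  have eq: "frechet_derivative f (at x) = frechet_derivative g (at x)" if "x \<in> S" for x
    using frechet_derivative_at[OF der[OF that]] .
  have "Ck_on k S (\<lambda>x. frechet_derivative g (at x) v)" for v
    by (rule Suc.IH[of "\<lambda>x. frechet_derivative f (at x) v"]) (use Suc.prems(2) eq in auto)
  then show ?case using der by (auto simp: differentiable_def)
qed

text \<open>Allows an explicit derivative in place of the chosen \<open>frechet_derivative\<close>;
  together with \<open>Ck_on_SucE\<close> it drives the inductions on \<open>k\<close>.\<close>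

lemma Ck_on_SucI:
  assumes "open S" "\<And>x. x \<in> S \<Longrightarrow> (f has_derivative f' x) (at x)"
    and "\<And>v. Ck_on k S (\<lambda>x. f' x v)"
  shows "Ck_on (Suc k) S f"
proof -
  have "Ck_on k S (\<lambda>x. frechet_derivative f (at x) v)" for v
    by (rule Ck_on_cong[OF assms(1) _ assms(3)[of v]]) (simp add: frechet_derivative_at[OF assms(2)])
  then show ?thesis using assms(2) by (auto simp: differentiable_def)
qed

lemma Ck_on_SucE:
  assumes "Ck_on (Suc k) S f"
  obtains f' where "\<And>x. x \<in> S \<Longrightarrow> (f has_derivative f' x) (at x)" "\<And>v. Ck_on k S (\<lambda>x. f' x v)"
proof
  show "(f has_derivative frechet_derivative f (at x)) (at x)" if "x \<in> S" for x
    using assms that by (simp add: frechet_derivative_works)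
  show "Ck_on k S (\<lambda>x. frechet_derivative f (at x) v)" for v
    using assms by simp
qed

text \<open>\<open>Ck_on (Suc k)\<close> does not literally contain the lower orders; they are
  recovered from the bottom, where differentiability gives continuity.\<close>

lemma Ck_on_Suc_imp:
  assumes "open S" shows "Ck_on (Suc k) S f \<Longrightarrow> Ck_on k S f"
proof (induction k arbitrary: f)
  case 0
  then show ?case
    by (auto intro!: continuous_at_imp_continuous_on differentiable_imp_continuous_within)
next
  case (Suc k)
  obtain f' where f: "\<And>x. x \<in> S \<Longrightarrow> (f has_derivative f' x) (at x)"
    "\<And>v. Ck_on (Suc k) S (\<lambda>x. f' x v)"
    using Suc.prems by (rule Ck_on_SucE) blast
  show ?case
    by (rule Ck_on_SucI[OF assms]) (auto simp del: Ck_on.simps(2) intro: f Suc.IH)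
qed

text \<open>Derivatives are taken \<open>at x\<close> in the whole space, so the set matters only
  for the continuity at order 0, where openness glues.\<close>

lemma Ck_on_Un:
  assumes "open S" "open T" "Ck_on k S f" "Ck_on k T f"
  shows "Ck_on k (S \<union> T) f"
  using assms(3,4) by (induction k arbitrary: f) (auto intro: continuous_on_open_Un assms(1,2))

lemma Ck_on_const: "open S \<Longrightarrow> Ck_on k S (\<lambda>x. c)"
proof (induction k arbitrary: c)
  case (Suc k)
  then show ?case by (intro Ck_on_SucI[where f'="\<lambda>x v. 0"]) auto
qed simp

lemma Ck_on_bounded_linear:
  assumes "open S" "bounded_linear f" shows "Ck_on k S f"
proof (cases k)
  case (Suc m)
  show ?thesis unfolding Suc
    by (rule Ck_on_SucI[where f'="\<lambda>x. f"])
      (use assms in \<open>auto intro: bounded_linear_imp_has_derivative Ck_on_const\<close>)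
qed (use assms linear_continuous_on in auto)

lemma Ck_on_add:
  assumes "open S" "Ck_on k S f" "Ck_on k S g"
  shows "Ck_on k S (\<lambda>x. f x + g x)"
  using assms(2,3)
proof (induction k arbitrary: f g)
  case 0
  then show ?case by (auto intro: continuous_on_add)
next
  case (Suc k)
  obtain f' where f: "\<And>x. x \<in> S \<Longrightarrow> (f has_derivative f' x) (at x)" "\<And>v. Ck_on k S (\<lambda>x. f' x v)"
    using Suc.prems(1) by (rule Ck_on_SucE) blast
  obtain g' where g: "\<And>x. x \<in> S \<Longrightarrow> (g has_derivative g' x) (at x)" "\<And>v. Ck_on k S (\<lambda>x. g' x v)"
    using Suc.prems(2) by (rule Ck_on_SucE) blast
  show ?case
    by (rule Ck_on_SucI[OF assms(1), where f'="\<lambda>x v. f' x v + g' x v"])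
      (auto intro: has_derivative_add f g Suc.IH)
qed

lemma (in bounded_bilinear) Ck_on:
  assumes "open S" "Ck_on k S f" "Ck_on k S g"
  shows "Ck_on k S (\<lambda>x. prod (f x) (g x))"
  using assms(2,3)
proof (induction k arbitrary: f g)
  case 0
  then show ?case by (auto intro: continuous_on)
next
  case (Suc k)
  obtain f' where f: "\<And>x. x \<in> S \<Longrightarrow> (f has_derivative f' x) (at x)" "\<And>v. Ck_on k S (\<lambda>x. f' x v)"
    using Suc.prems(1) by (rule Ck_on_SucE) blast
  obtain g' where g: "\<And>x. x \<in> S \<Longrightarrow> (g has_derivative g' x) (at x)" "\<And>v. Ck_on k S (\<lambda>x. g' x v)"
    using Suc.prems(2) by (rule Ck_on_SucE) blast
  show ?case
    by (rule Ck_on_SucI[OF assms(1), where f'="\<lambda>x v. prod (f x) (g' x v) + prod (f' x v) (g x)"])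
      (auto intro!: FDERIV Ck_on_add assms(1) f g Suc.IH Ck_on_Suc_imp[OF assms(1) Suc.prems(1)]
        Ck_on_Suc_imp[OF assms(1) Suc.prems(2)])
qed

lemmas Ck_on_mult = bounded_bilinear.Ck_on[OF bounded_bilinear_mult]
lemmas Ck_on_scaleR = bounded_bilinear.Ck_on[OF bounded_bilinear_scaleR]
lemmas Ck_on_inner = bounded_bilinear.Ck_on[OF bounded_bilinear_inner]

lemma Ck_on_sum:
  assumes "open S" "\<And>i. i \<in> I \<Longrightarrow> Ck_on k S (f i)"
  shows "Ck_on k S (\<lambda>x. \<Sum>i\<in>I. f i x)"
  using assms(2) by (induction I rule: infinite_finite_induct) (auto intro: Ck_on_const Ck_on_add assms(1))

text \<open>\<open>Ck_on\<close> controls derivatives in fixed directions only, but the chain rule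
  yields \<open>f' (g x)\<close> in the moving direction \<open>g' x v\<close>. Expanding that
  direction in the basis of the Euclidean middle space leaves fixed directions with smooth
  coefficients.\<close>

lemma Ck_on_compose:
  fixes g :: "'c::real_normed_vector \<Rightarrow> 'e::euclidean_space"
  assumes "open S" "g ` S \<subseteq> T" "Ck_on k T f" "Ck_on k S g"
  shows "Ck_on k S (\<lambda>x. f (g x))"
  using assms(3,4)
proof (induction k arbitrary: f)
  case 0
  then show ?case using continuous_on_compose2[of T f S g] assms(2) by auto
next
  case (Suc k)
  obtain f' where f: "\<And>x. x \<in> T \<Longrightarrow> (f has_derivative f' x) (at x)" "\<And>v. Ck_on k T (\<lambda>x. f' x v)"
    using Suc.prems(1) by (rule Ck_on_SucE) blast
  obtain g' where g: "\<And>x. x \<in> S \<Longrightarrow> (g has_derivative g' x) (at x)" "\<And>v. Ck_on k S (\<lambda>x. g' x v)"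
    using Suc.prems(2) by (rule Ck_on_SucE) blast
  have rep: "(f' (g x) \<circ> g' x) = (\<lambda>v. \<Sum>b\<in>Basis. (g' x v \<bullet> b) *\<^sub>R f' (g x) b)" if "x \<in> S" for x
  proof
    fix v
    have lin: "linear (f' (g x))"
      using f(1) that assms(2) by (blast intro: has_derivative_linear)
    have "f' (g x) (\<Sum>b\<in>Basis. (g' x v \<bullet> b) *\<^sub>R b) = (\<Sum>b\<in>Basis. (g' x v \<bullet> b) *\<^sub>R f' (g x) b)"
      by (simp only: linear_sum[OF lin] linear_scale[OF lin])
    then show "(f' (g x) \<circ> g' x) v = (\<Sum>b\<in>Basis. (g' x v \<bullet> b) *\<^sub>R f' (g x) b)"
      by (simp add: euclidean_representation)
  qed
  show ?case
  proof (rule Ck_on_SucI[OF assms(1), where f'="\<lambda>x v. \<Sum>b\<in>Basis. (g' x v \<bullet> b) *\<^sub>R f' (g x) b"])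
    fix x assume x: "x \<in> S"
    have "(f \<circ> g has_derivative f' (g x) \<circ> g' x) (at x)"
      using x f(1) g(1) assms(2) by (intro diff_chain_at) auto
    then show "((\<lambda>x. f (g x)) has_derivative (\<lambda>v. \<Sum>b\<in>Basis. (g' x v \<bullet> b) *\<^sub>R f' (g x) b)) (at x)"
      by (simp add: o_def rep[OF x, unfolded o_def])
  next
    show "Ck_on k S (\<lambda>x. \<Sum>b\<in>Basis. (g' x v \<bullet> b) *\<^sub>R f' (g x) b)" for v
      by (intro Ck_on_sum Ck_on_scaleR Ck_on_inner assms(1) Ck_on_const g(2) Suc.IH f(2)
          Ck_on_Suc_imp[OF assms(1) Suc.prems(2)])
  qed
qed

subsection \<open>A bump function\<close>

text \<open>\<open>flat 0\<close> is the classical flat function. The powers of \<open>1 / t\<close>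
  make the family closed under differentiation up to linear combinations, so one induction proves
  smoothness for all \<open>m\<close> at once.\<close>

definition flat :: "nat \<Rightarrow> real \<Rightarrow> real" where
  "flat m t = (if t > 0 then (1 / t) ^ m * exp (- 1 / t) else 0)"

lemma flat_tendsto_0: "(flat m \<longlongrightarrow> 0) (at 0)"
proof -
  have "((\<lambda>t. (1 / t) ^ m * exp (- 1 / t)) \<longlongrightarrow> (0::real)) (at_right 0)"
    by real_asymp
  then have "(flat m \<longlongrightarrow> 0) (at_right 0)"
    by (rule Lim_transform_eventually)
      (auto simp: flat_def eventually_at_filter)
  moreover have "(flat m \<longlongrightarrow> 0) (at_left 0)"
    by (rule Lim_transform_eventually[OF tendsto_const])
      (auto simp: flat_def eventually_at_filter)
  ultimately show ?thesis
    by (simp add: filterlim_split_at)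
qed

lemma flat_has_field_derivative:
  "(flat m has_field_derivative flat (m + 2) t - real m * flat (m + 1) t) (at t)"
proof -
  consider "t > 0" | "t < 0" | "t = 0" by linarith
  then show ?thesis
  proof cases
    case 1
    have "((\<lambda>t. 1 / t) has_field_derivative - ((1 / t)\<^sup>2)) (at t)"
      using 1 by (auto intro!: derivative_eq_intros simp: power2_eq_square)
    from DERIV_power[OF this, of m]
    have "((\<lambda>t. (1 / t) ^ m) has_field_derivative - (real m * (1 / t) ^ (m + 1))) (at t)"
      by (rule DERIV_cong) (cases m, simp_all add: power2_eq_square)
    moreover have "((\<lambda>t. exp (- 1 / t)) has_field_derivative (1 / t)\<^sup>2 * exp (- 1 / t)) (at t)"
      using 1 by (auto intro!: derivative_eq_intros simp: field_simps power2_eq_square)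
    ultimately have "((\<lambda>t. (1 / t) ^ m * exp (- 1 / t)) has_field_derivative
        flat (m + 2) t - real m * flat (m + 1) t) (at t)"
      by (rule DERIV_mult[THEN DERIV_cong])
        (use 1 in \<open>simp add: flat_def algebra_simps power2_eq_square\<close>)
    then show ?thesis
      by (rule has_field_derivative_transform_within_open[where S="{0<..}"]) (use 1 in \<open>auto simp: flat_def\<close>)
  next
    case 2
    have "((\<lambda>t. 0) has_field_derivative flat (m + 2) t - real m * flat (m + 1) t) (at t)"
      using 2 by (auto simp: flat_def)
    then show ?thesis
      by (rule has_field_derivative_transform_within_open[where S="{..<0}"]) (use 2 in \<open>auto simp: flat_def\<close>)
  next
    case 3
    \<comment> \<open>Away from 0 the difference quotient is \<open>flat (Suc m)\<close>
      itself.\<close>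
    have "((\<lambda>h. (flat m (0 + h) - flat m 0) / h) \<longlongrightarrow> 0) (at 0)"
      by (rule Lim_transform_eventually[OF flat_tendsto_0[of "Suc m"]])
        (auto simp: flat_def eventually_at_filter field_simps)
    then show ?thesis using 3 by (simp add: DERIV_def flat_def)
  qed
qed

lemma Ck_on_flat: "Ck_on k UNIV (flat m)"
proof (induction k arbitrary: m)
  case 0
  have "isCont (flat m) t" for t
    using flat_has_field_derivative by (rule DERIV_isCont)
  then show ?case by (simp add: continuous_at_imp_continuous_on)
next
  case (Suc k)
  show ?case
  proof (rule Ck_on_SucI)
    show "(flat m has_derivative (\<lambda>v. (flat (m + 2) t + - real m * flat (m + 1) t) * v)) (at t)" for t
      using flat_has_field_derivative[of m t] by (simp add: has_field_derivative_def)
    show "Ck_on k UNIV (\<lambda>t. (flat (m + 2) t + - real m * flat (m + 1) t) * v)" for v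
      by (intro Ck_on_add Ck_on_mult Ck_on_const Suc.IH open_UNIV)
  qed simp
qed

text \<open>The squared norm keeps the argument polynomial, hence smooth at the center too. The bump
  has no plateau of value 1, so its value at the center is carried along as a nonzero factor
  later.\<close>

definition bump :: "'e::euclidean_space \<Rightarrow> real \<Rightarrow> 'e \<Rightarrow> real" where
  "bump a r x = flat 0 (r\<^sup>2 - (x - a) \<bullet> (x - a))"

lemma Ck_on_diff_const: "open S \<Longrightarrow> Ck_on k S (\<lambda>x. x - a)"
  using Ck_on_add[OF _ Ck_on_bounded_linear[OF _ bounded_linear_ident] Ck_on_const[of S k "- a"]] by simp

lemma Ck_on_bump: assumes "open S" shows "Ck_on k S (bump a r)"
proof -
  have *: "Ck_on k S (\<lambda>x. r\<^sup>2 + (- 1) * ((x - a) \<bullet> (x - a)))"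
    by (intro Ck_on_add Ck_on_mult Ck_on_inner Ck_on_const Ck_on_diff_const assms)
  have "Ck_on k S (\<lambda>x. flat 0 (r\<^sup>2 + (- 1) * ((x - a) \<bullet> (x - a))))"
    by (rule Ck_on_compose[OF assms _ Ck_on_flat *]) simp
  then show ?thesis by (simp add: bump_def[abs_def])
qed

lemma bump_center: "r > 0 \<Longrightarrow> bump a r a \<noteq> 0"
  by (simp add: bump_def flat_def)

lemma bump_eq_0: assumes "r \<ge> 0" "x \<notin> cball a r" shows "bump a r x = 0"
proof -
  have "r\<^sup>2 \<le> (norm (x - a))\<^sup>2"
    using assms by (intro power_mono) (auto simp: dist_norm norm_minus_commute)
  then show ?thesis by (simp add: bump_def flat_def power2_norm_eq_inner)
qed

subsection \<open>Extending tangent vectors to vector fields\<close>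

lemma sum_fun_apply: "(\<Sum>i\<in>I. F i) x = (\<Sum>i\<in>I. F i x)"
  by (induction I rule: infinite_finite_induct) simp_all

lemma subspace_tangent_space: "subspace (tangent_space A p)"
  by (rule subspaceI) (auto simp: tangent_space_def algebra_simps)

locale smooth_manifold =
  fixes A :: "('a::{t2_space,second_countable_topology}, 'e::euclidean_space) chart set"
  assumes atlas: "smooth_atlas A"
begin

lemma
  assumes "(U, c) \<in> A"
  shows open_chart: "open U"
    and open_chart_image: "open (c ` U)"
    and homeomorphism_chart: "homeomorphism U (c ` U) c (inv_into U c)"
proof -
  have "\<forall>(U, c)\<in>A. open U \<and> open (c ` U) \<and> homeomorphism U (c ` U) c (inv_into U c)"
    using atlas unfolding smooth_atlas_def by (elim conjE)
  from bspec[OF this assms]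
  show "open U" "open (c ` U)" "homeomorphism U (c ` U) c (inv_into U c)" by simp_all
qed

lemma smooth_on_transition:
  assumes "(U, c) \<in> A" "(V, d) \<in> A"
  shows "smooth_on (c ` (U \<inter> V)) (d \<circ> inv_into U c)"
proof -
  have "\<forall>(U, c)\<in>A. \<forall>(V, d)\<in>A. smooth_on (c ` (U \<inter> V)) (d \<circ> inv_into U c)"
    using atlas unfolding smooth_atlas_def by (elim conjE)
  from bspec[OF this assms(1), simplified prod.case, THEN bspec, OF assms(2)]
  show ?thesis by simp
qed

lemma inv_chart [simp]: "(U, c) \<in> A \<Longrightarrow> q \<in> U \<Longrightarrow> inv_into U c (c q) = q"
  by (rule homeomorphism_apply1[OF homeomorphism_chart])

lemma chart_at: obtains U c where "(U, c) \<in> A" "p \<in> U"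
proof -
  have "p \<in> (\<Union>(U, c)\<in>A. U)" using atlas by (simp add: smooth_atlas_def)
  then show thesis using that by (auto split: prod.splits)
qed

lemma open_chart_image_subset:
  assumes "(U, c) \<in> A" "open W" "W \<subseteq> U" shows "open (c ` W)"
proof -
  have "openin (top_of_set (c ` U)) (c ` W)"
    using assms(2,3)
    by (intro homeomorphism_imp_open_map[OF homeomorphism_chart[OF assms(1)]] open_subset)
  then show ?thesis using open_chart_image[OF assms(1)] by (rule openin_open_trans)
qed

section \<open>Smooth functions, their extension by zero, and cut-off coordinate fields\<close>

lemma smooth_fnsI:
  "(\<And>U c k. (U, c) \<in> A \<Longrightarrow> Ck_on k (c ` U) (f \<circ> inv_into U c)) \<Longrightarrow> f \<in> smooth_fns A"
  by (auto simp: smooth_fns_def smooth_on_def)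

lemma smooth_fnsD: "f \<in> smooth_fns A \<Longrightarrow> (U, c) \<in> A \<Longrightarrow> Ck_on k (c ` U) (f \<circ> inv_into U c)"
  by (auto simp: smooth_fns_def smooth_on_def)

lemma smooth_fns_const: "(\<lambda>q. a) \<in> smooth_fns A"
  by (rule smooth_fnsI) (simp add: o_def Ck_on_const open_chart_image)

lemma smooth_fns_add: "f \<in> smooth_fns A \<Longrightarrow> g \<in> smooth_fns A \<Longrightarrow> (\<lambda>q. f q + g q) \<in> smooth_fns A"
  by (rule smooth_fnsI) (unfold o_def, intro Ck_on_add open_chart_image smooth_fnsD[unfolded o_def])

lemma smooth_fns_mult: "f \<in> smooth_fns A \<Longrightarrow> g \<in> smooth_fns A \<Longrightarrow> (\<lambda>q. f q * g q) \<in> smooth_fns A"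
  by (rule smooth_fnsI) (unfold o_def, intro Ck_on_mult open_chart_image smooth_fnsD[unfolded o_def])

lemma smooth_fns_cmult: "f \<in> smooth_fns A \<Longrightarrow> (\<lambda>q. a * f q) \<in> smooth_fns A"
  by (intro smooth_fns_mult smooth_fns_const)

lemma subspace_vfields: "subspace (vfields A)"
proof (rule subspaceI)
  show "0 \<in> vfields A"
    by (auto simp: vfields_def smooth_fns_const subspace_0[OF subspace_tangent_space])
  show "X + Y \<in> vfields A" if "X \<in> vfields A" "Y \<in> vfields A" for X Y
    using that by (auto simp: vfields_def smooth_fns_add subspace_add[OF subspace_tangent_space])
  show "a *\<^sub>R X \<in> vfields A" if "X \<in> vfields A" for a X
    using that by (auto simp: vfields_def smooth_fns_cmult subspace_scale[OF subspace_tangent_space])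
qed

text \<open>The preimage \<open>C\<close> of \<open>K\<close> is compact, hence closed in the
  Hausdorff space. Any chart domain \<open>V\<close> is therefore the union of the open sets
  \<open>V \<inter> U\<close>, where the function is \<open>G\<close> after a transition map, and
  \<open>V - C\<close>, where it is zero.\<close>

lemma smooth_fns_extend_by_0:
  assumes c: "(U, c) \<in> A" and G: "\<And>k. Ck_on k (c ` U) G"
    and K: "compact K" "K \<subseteq> c ` U" "\<And>x. x \<notin> K \<Longrightarrow> G x = 0"
  shows "(\<lambda>q. if q \<in> U then G (c q) else 0) \<in> smooth_fns A" (is "?f \<in> _")
proof (rule smooth_fnsI)
  fix V d k assume d: "(V, d) \<in> A"
  define C where "C = inv_into U c ` K"
  have "compact C" unfolding C_def
    using homeomorphism_chart[OF c] K
    by (auto simp: homeomorphism_def intro: compact_continuous_image continuous_on_subset)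
  then have cl: "closed C" by (rule compact_imp_closed)
  have CU: "C \<subseteq> U" using K(2) inv_into_into[of _ c U] by (auto simp: C_def)
  have CK: "c q \<notin> K" if "q \<in> U" "q \<notin> C" for q
  proof
    assume "c q \<in> K"
    then have "inv_into U c (c q) \<in> C" by (simp add: C_def)
    then show False using that c by simp
  qed
  have op: "open (d ` (V \<inter> U))" "open (d ` (V - C))"
    by (rule open_chart_image_subset[OF d];
        simp add: open_chart[OF c] open_chart[OF d] cl open_Int open_Diff Diff_subset)+
  have "Ck_on k (d ` (V \<inter> U)) (c \<circ> inv_into V d)"
    using smooth_on_transition[OF d c] unfolding smooth_on_def ..
  from Ck_on_compose[OF op(1) _ G this]
  have "Ck_on k (d ` (V \<inter> U)) (\<lambda>x. G ((c \<circ> inv_into V d) x))"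
    using d by (fastforce simp: o_def)
  then have 1: "Ck_on k (d ` (V \<inter> U)) (?f \<circ> inv_into V d)"
    by (rule Ck_on_cong[OF op(1), rotated]) (use d in auto)
  have 2: "Ck_on k (d ` (V - C)) (?f \<circ> inv_into V d)"
    by (rule Ck_on_cong[OF op(2) _ Ck_on_const[OF op(2), of _ 0]]) (use d K(3) CK in auto)
  have "d ` V = d ` (V \<inter> U) \<union> d ` (V - C)" using CU by auto
  then show "Ck_on k (d ` V) (?f \<circ> inv_into V d)"
    using Ck_on_Un[OF op 1 2] by simp
qed

text \<open>A cut-off \<open>b\<close> with compact support in the chart image turns the local
  coordinate field into a global one. The test for smooth \<open>f\<close> follows the convention
  built into \<open>tangent_space\<close>.\<close>

definition coord_field :: "'a set \<Rightarrow> ('a \<Rightarrow> 'e) \<Rightarrow> ('e \<Rightarrow> real) \<Rightarrow> 'e \<Rightarrow> 'a vfield" where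
  "coord_field U c b e q f = (if f \<in> smooth_fns A \<and> q \<in> U
     then b (c q) * frechet_derivative (f \<circ> inv_into U c) (at (c q)) e else 0)"

lemma smooth_fns_has_derivative:
  assumes "(U, c) \<in> A" "f \<in> smooth_fns A" "x \<in> c ` U"
  shows "((\<lambda>x. f (inv_into U c x)) has_derivative frechet_derivative (\<lambda>x. f (inv_into U c x)) (at x)) (at x)"
proof -
  have "(\<lambda>x. f (inv_into U c x)) differentiable (at x)"
    using smooth_fnsD[OF assms(2,1), of "Suc 0"] assms(3) unfolding Ck_on.simps o_def by blast
  then show ?thesis by (rule frechet_derivative_works[THEN iffD1])
qed

lemma coord_field_in_tangent_space:
  assumes c: "(U, c) \<in> A"
  shows "coord_field U c b e q \<in> tangent_space A q"
proof (cases "q \<in> U")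
  case True
  let ?D = "\<lambda>f. frechet_derivative (\<lambda>x. f (inv_into U c x)) (at (c q))"
  have D: "((\<lambda>x. f (inv_into U c x)) has_derivative ?D f) (at (c q))" if "f \<in> smooth_fns A" for f
    using smooth_fns_has_derivative[OF c that] True by simp
  have add: "?D (\<lambda>q. f q + g q) = (\<lambda>v. ?D f v + ?D g v)"
    if "f \<in> smooth_fns A" "g \<in> smooth_fns A" for f g
    using frechet_derivative_at[OF has_derivative_add[OF D D], OF that] by simp
  have mult: "?D (\<lambda>q. f q * g q) = (\<lambda>v. f q * ?D g v + ?D f v * g q)"
    if "f \<in> smooth_fns A" "g \<in> smooth_fns A" for f g
    using frechet_derivative_at[OF has_derivative_mult[OF D D], OF that] c True by simp
  have cmult: "?D (\<lambda>q. a * f q) = (\<lambda>v. a * ?D f v)" if "f \<in> smooth_fns A" for f a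
    using frechet_derivative_at[OF has_derivative_mult_right[OF D], OF that] by simp
  show ?thesis
    by (auto simp: tangent_space_def coord_field_def o_def add mult cmult smooth_fns_add
        smooth_fns_mult smooth_fns_cmult algebra_simps)
qed (auto simp: tangent_space_def coord_field_def)

lemma coord_field_in_vfields:
  assumes c: "(U, c) \<in> A" and b: "\<And>k. Ck_on k (c ` U) b"
    and K: "compact K" "K \<subseteq> c ` U" "\<And>x. x \<notin> K \<Longrightarrow> b x = 0"
  shows "coord_field U c b e \<in> vfields A"
proof -
  have "(\<lambda>q. coord_field U c b e q f) \<in> smooth_fns A" if f: "f \<in> smooth_fns A" for f
  proof -
    have "(\<lambda>q. if q \<in> U then b (c q) * frechet_derivative (f \<circ> inv_into U c) (at (c q)) e else 0)
        \<in> smooth_fns A"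
    proof (rule smooth_fns_extend_by_0[OF c _ K(1,2)])
      show "Ck_on k (c ` U) (\<lambda>x. b x * frechet_derivative (f \<circ> inv_into U c) (at x) e)" for k
        \<comment> \<open>Differentiation costs one order.\<close>
        using smooth_fnsD[OF f c, of "Suc k"]
        by (intro Ck_on_mult[OF open_chart_image[OF c] b]) simp
    qed (simp add: K(3))
    then show ?thesis using f by (simp add: coord_field_def[abs_def])
  qed
  then show ?thesis by (simp add: vfields_def coord_field_in_tangent_space[OF c])
qed

text \<open>Cut-off coordinate fields are paired at \<open>p\<close> with cut-off coordinate
  functions; the resulting matrix is a nonzero multiple of the identity.\<close>

lemma independent_vfield_values:
  obtains E where "independent E" "card E = DIM('e)" "finite E" "E \<subseteq> (\<lambda>X. X p) ` vfields A"
proof -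
  obtain U c where c: "(U, c) \<in> A" and p: "p \<in> U" by (rule chart_at)
  obtain r where r: "r > 0" "cball (c p) r \<subseteq> c ` U"
    using open_chart_image[OF c] p open_contains_cball by blast
  define b where "b = bump (c p) r"
  have b: "Ck_on k (c ` U) b" for k
    unfolding b_def by (rule Ck_on_bump[OF open_chart_image[OF c]])
  have b0: "b x = 0" if "x \<notin> cball (c p) r" for x
    using bump_eq_0[OF _ that] r(1) by (simp add: b_def)
  have bp: "b (c p) \<noteq> 0" using bump_center[OF r(1)] by (simp add: b_def)
  define X where "X = coord_field U c b"
  have X: "X e \<in> vfields A" for e
    unfolding X_def by (rule coord_field_in_vfields[OF c b _ r(2) b0]) simp_all
  \<comment> \<open>Centering the coordinate at \<open>p\<close> removes the derivative of the bump
    from the product rule there.\<close>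
  define f where "f j q = (if q \<in> U then b (c q) * ((c q - c p) \<bullet> j) else 0)" for j q
  have f: "f j \<in> smooth_fns A" for j
    unfolding f_def[abs_def]
  proof (rule smooth_fns_extend_by_0[OF c _ compact_cball r(2)])
    show "Ck_on k (c ` U) (\<lambda>x. b x * ((x - c p) \<bullet> j))" for k
      by (intro Ck_on_mult Ck_on_inner Ck_on_diff_const Ck_on_const b open_chart_image[OF c])
  qed (simp add: b0)
  have Xf: "X e p (f j) = (b (c p))\<^sup>2 * (e \<bullet> j)" for e j
  proof -
    obtain b' where b': "(b has_derivative b') (at (c p))"
      using b[of 1] p by (auto simp: differentiable_def)
    have "((\<lambda>x. b x * ((x - c p) \<bullet> j)) has_derivative
        (\<lambda>v. b (c p) * ((v - 0) \<bullet> j) + b' v * ((c p - c p) \<bullet> j))) (at (c p))"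
      by (intro has_derivative_mult b' has_derivative_inner_left has_derivative_diff
          has_derivative_ident has_derivative_const)
    then have "((f j \<circ> inv_into U c) has_derivative (\<lambda>v. b (c p) * (v \<bullet> j))) (at (c p))"
      by (rule has_derivative_transform_within_open[OF has_derivative_eq_rhs open_chart_image[OF c]])
        (use p c in \<open>auto simp: f_def\<close>)
    from frechet_derivative_at[OF this, symmetric] show ?thesis
      using p f by (simp add: X_def coord_field_def power2_eq_square)
  qed
  define Y where "Y e = X e p" for e
  have Yf: "Y e (f j) = (b (c p))\<^sup>2 * (e \<bullet> j)" for e j
    unfolding Y_def by (rule Xf)
  have inj: "inj_on Y Basis"
  proof (rule inj_onI)
    fix i j :: 'e assume "i \<in> Basis" "j \<in> Basis" and eq: "Y i = Y j"
    then show "i = j" using fun_cong[OF eq, of "f i"] bp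
      unfolding Yf by (simp add: inner_Basis split: if_splits)
  qed
  define E where "E = Y ` Basis"
  have scalars: "u w = 0" if sum0: "(\<Sum>x\<in>E. u x *\<^sub>R x) = 0" and "w \<in> E" for u w
  proof -
    obtain j where j: "j \<in> Basis" "w = Y j" using \<open>w \<in> E\<close> unfolding E_def by blast
    have "(\<Sum>e\<in>Basis. u (Y e) *\<^sub>R Y e) = 0"
      using sum0 unfolding E_def sum.reindex[OF inj] by (simp add: o_def)
    then have "(\<Sum>e\<in>Basis. u (Y e) *\<^sub>R Y e) (f j) = 0"
      by (simp only: zero_fun_apply)
    moreover have "(\<Sum>e\<in>Basis. u (Y e) *\<^sub>R Y e) (f j)
        = (\<Sum>e\<in>Basis. if e = j then u w * (b (c p))\<^sup>2 else 0)"
      unfolding sum_fun_apply scaleR_fun_apply Yf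
      by (rule sum.cong) (use j in \<open>auto simp: inner_Basis\<close>)
    ultimately have "u w * (b (c p))\<^sup>2 = 0"
      using j(1) by simp
    then show ?thesis using bp by simp
  qed
  have fin: "finite E" by (simp add: E_def)
  moreover have "independent E"
    unfolding dependent_finite[OF fin]
  proof
    assume "\<exists>u. (\<exists>v\<in>E. u v \<noteq> 0) \<and> (\<Sum>v\<in>E. u v *\<^sub>R v) = 0"
    then obtain u w where "w \<in> E" "u w \<noteq> 0" "(\<Sum>v\<in>E. u v *\<^sub>R v) = 0" by blast
    with scalars[of u w] show False by simp
  qed
  moreover have "card E = DIM('e)" by (simp add: E_def card_image[OF inj])
  moreover have "E \<subseteq> (\<lambda>X. X p) ` vfields A" using X by (auto simp: E_def Y_def)
  ultimately show thesis using that by blast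
qed

text \<open>A vector outside \<open>span E\<close> would give \<open>DIM('e) + 1\<close> independent
  vectors inside \<open>span B\<close>. So \<open>E\<close> spans, and the values at
  \<open>p\<close> of vector fields form a subspace containing \<open>E\<close>.\<close>

lemma tangent_vector_extends:
  assumes B: "finite B" "tangent_space A p \<subseteq> span B" "card B \<le> DIM('e)"
    and v: "v \<in> tangent_space A p"
  shows "\<exists>X\<in>vfields A. X p = v"
proof -
  obtain E where E: "independent E" "card E = DIM('e)" "finite E" "E \<subseteq> (\<lambda>X. X p) ` vfields A"
    by (rule independent_vfield_values)
  have "v \<in> span E"
  proof (rule ccontr)
    assume nin: "v \<notin> span E"
    have "insert v E \<subseteq> span B"
      using E(4) B(2) v by (auto simp: vfields_def)
    moreover have "independent (insert v E)" using nin E(1) by (rule independent_insertI)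
    ultimately have "card (insert v E) \<le> card B"
      using independent_span_bound[OF B(1)] by blast
    moreover have "v \<notin> E" using nin span_base by blast
    ultimately show False using E(2,3) B(3) by simp
  qed
  moreover have "subspace ((\<lambda>X. X p) ` vfields A)"
    by (rule linear_subspace_image[OF _ subspace_vfields]) (auto intro: linearI)
  ultimately show ?thesis using span_minimal[OF E(4)] by auto
qed

end

section \<open>Traces, maps linear on a subspace, and brackets\<close>

lemma trace_on_eq_0:
  assumes "\<And>v. v \<in> V \<Longrightarrow> T v = 0"
  shows "trace_on V T = 0"
proof -
  define B where "B = (SOME B. B \<subseteq> V \<and> independent B \<and> V \<subseteq> span B)"
  have "\<exists>B. B \<subseteq> V \<and> independent B \<and> V \<subseteq> span B"
    using maximal_independent_subset[of V] by metis
  then have "B \<subseteq> V \<and> independent B \<and> V \<subseteq> span B"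
    unfolding B_def by (rule someI_ex)
  then have "(\<Sum>b\<in>B. representation B (T b) b) = 0"
    using assms by (intro sum.neutral) (auto simp: representation_zero)
  then show ?thesis by (simp add: trace_on_def B_def)
qed

lemma linear_over_add: "linear_over V T \<Longrightarrow> u \<in> V \<Longrightarrow> v \<in> V \<Longrightarrow> T (u + v) = T u + T v"
  and linear_over_scale: "linear_over V T \<Longrightarrow> v \<in> V \<Longrightarrow> T (a *\<^sub>R v) = a *\<^sub>R T v"
  unfolding linear_over_def by simp_all

lemma linear_over_zero: "linear_over V T \<Longrightarrow> 0 \<in> V \<Longrightarrow> T 0 = 0"
  using linear_over_scale[of V T 0 0] by simp

lemma linear_over_minus: "linear_over V T \<Longrightarrow> v \<in> V \<Longrightarrow> T (- v) = - T v"
  using linear_over_scale[of V T v "-1"] by simp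

lemma linear_over_diff:
  assumes "linear_over V T" "subspace V" "u \<in> V" "v \<in> V" shows "T (u - v) = T u - T v"
  using linear_over_add[OF assms(1,3) subspace_neg[OF assms(2,4)]] linear_over_minus[OF assms(1,4)]
  by simp

lemma lie_bracket_anticommute: "lie_bracket X Y = - lie_bracket Y X"
  by (simp add: lie_bracket_def fun_eq_iff)

lemma vfield_value: "X \<in> vfields A \<Longrightarrow> X p \<in> tangent_space A p"
  by (simp add: vfields_def)

context smooth_manifold
begin

text \<open>The Leibniz rule at \<open>1 * 1\<close> says that the derivative of 1 equals twice
  itself; homogeneity does the rest.\<close>

lemma vfield_const:
  assumes "X \<in> vfields A" shows "X p (\<lambda>q. a) = 0"
proof -
  have D: "X p (\<lambda>q. f q * g q) = X p f * g p + f p * X p g"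
    if "f \<in> smooth_fns A" "g \<in> smooth_fns A" for f g
    using vfield_value[OF assms, of p] that unfolding tangent_space_def by blast
  have S: "X p (\<lambda>q. a * f q) = a * X p f" if "f \<in> smooth_fns A" for f
    using vfield_value[OF assms, of p] that unfolding tangent_space_def by blast
  have "X p (\<lambda>q. 1) = 0" using D[OF smooth_fns_const smooth_fns_const, of 1 1] by simp
  then show ?thesis using S[OF smooth_fns_const[of 1]] by simp
qed

lemma lie_bracket_zero_right: "X \<in> vfields A \<Longrightarrow> lie_bracket X (\<lambda>q. 0) = 0"
  by (simp add: lie_bracket_def fun_eq_iff vfield_const)

end

subsection \<open>Para-cosymplectic manifolds\<close>

locale para_cosymplectic_manifold =
  fixes A :: "('a::{t2_space,second_countable_topology}, 'e::euclidean_space) chart set"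
    and n :: nat
    and \<phi> :: "'a \<Rightarrow> 'a tvec \<Rightarrow> 'a tvec"
    and \<zeta> :: "'a vfield"
    and \<eta> :: "'a \<Rightarrow> 'a tvec \<Rightarrow> real"
    and g :: "'a \<Rightarrow> 'a tvec \<Rightarrow> 'a tvec \<Rightarrow> real"
    and nabla :: "'a vfield \<Rightarrow> 'a vfield \<Rightarrow> 'a vfield"
  assumes n_pos: "n \<ge> 1"
    and para_cosymplectic: "para_cosymplectic A n \<phi> \<zeta> \<eta> g"
    and levi_civita: "levi_civita A g nabla"
begin

section \<open>Pointwise algebra of the paracontact metric structure\<close>

abbreviation T where "T p \<equiv> tangent_space A p"
abbreviation VF where "VF \<equiv> vfields A"

lemma apm: "almost_paracontact_metric A n \<phi> \<zeta> \<eta> g"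
  using para_cosymplectic by (simp add: para_cosymplectic_def)

sublocale smooth_manifold A
  using apm by unfold_locales (simp add: almost_paracontact_metric_def)

lemma dim_eq: "DIM('e) = 2 * n + 1"
  and endo: "endo_field A \<phi>" and zeta: "\<zeta> \<in> VF" and eta: "one_form A \<eta>"
  and metric: "semi_riemannian_metric A g"
  using apm by (simp_all add: almost_paracontact_metric_def)

lemma phi_phi: "v \<in> T p \<Longrightarrow> \<phi> p (\<phi> p v) = v - \<eta> p v *\<^sub>R \<zeta> p"
  and eta_zeta [simp]: "\<eta> p (\<zeta> p) = 1"
  and g_phi_phi: "u \<in> T p \<Longrightarrow> v \<in> T p \<Longrightarrow> g p (\<phi> p u) (\<phi> p v) = - g p u v + \<eta> p u * \<eta> p v"
  and dim_eigenspaces: "dim {v \<in> T p. \<eta> p v = 0 \<and> \<phi> p v = v} = n"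
    "dim {v \<in> T p. \<eta> p v = 0 \<and> \<phi> p v = - v} = n"
  using apm by (simp_all add: almost_paracontact_metric_def)

lemma phi_in [simp]: "v \<in> T p \<Longrightarrow> \<phi> p v \<in> T p"
  and phi_linear: "linear_over (T p) (\<phi> p)"
  and phi_vfield: "X \<in> VF \<Longrightarrow> (\<lambda>q. \<phi> q (X q)) \<in> VF"
  using endo by (auto simp: endo_field_def)

lemma eta_linear: "linear_over (T p) (\<eta> p)"
  using eta by (simp add: one_form_def)

lemma g_bilinear: "bilinear_field A g"
  using metric by (simp add: semi_riemannian_metric_def)

lemma g_linear_right: "u \<in> T p \<Longrightarrow> linear_over (T p) (g p u)"
  and g_linear_left: "u \<in> T p \<Longrightarrow> linear_over (T p) (\<lambda>v. g p v u)"
  using g_bilinear by (simp_all add: bilinear_field_def)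

lemma g_sym: "u \<in> T p \<Longrightarrow> v \<in> T p \<Longrightarrow> g p u v = g p v u"
  and g_nondegenerate: "u \<in> T p \<Longrightarrow> (\<And>v. v \<in> T p \<Longrightarrow> g p u v = 0) \<Longrightarrow> u = 0"
  using metric unfolding semi_riemannian_metric_def by meson+

lemmas T_add [simp] = subspace_add[OF subspace_tangent_space]
  and T_diff [simp] = subspace_diff[OF subspace_tangent_space]
  and T_scale [simp] = subspace_scale[OF subspace_tangent_space]
  and T_zero [simp] = subspace_0[OF subspace_tangent_space]

lemmas phi_add = linear_over_add[OF phi_linear]
  and phi_diff = linear_over_diff[OF phi_linear subspace_tangent_space]
  and phi_scale = linear_over_scale[OF phi_linear]
  and phi_0 = linear_over_zero[OF phi_linear T_zero]
  and phi_minus = linear_over_minus[OF phi_linear]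
  and eta_add = linear_over_add[OF eta_linear]
  and eta_diff = linear_over_diff[OF eta_linear subspace_tangent_space]
  and eta_scale = linear_over_scale[OF eta_linear]
  and eta_0 = linear_over_zero[OF eta_linear T_zero]
  and g_add_right = linear_over_add[OF g_linear_right]
  and g_diff_right = linear_over_diff[OF g_linear_right subspace_tangent_space]
  and g_diff_left = linear_over_diff[OF g_linear_left subspace_tangent_space]
  and g_scale_right = linear_over_scale[OF g_linear_right]
  and g_minus_left = linear_over_minus[OF g_linear_left]
  and g_0_right = linear_over_zero[OF g_linear_right T_zero]
  and g_0_left = linear_over_zero[OF g_linear_left T_zero]

lemma zeta_in [simp]: "\<zeta> p \<in> T p"
  using zeta by (rule vfield_value)

lemma zeta_nonzero: "\<zeta> p \<noteq> 0"
  using eta_zeta[of p] eta_0[of p] by force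

text \<open>The square of \<phi> kills \<zeta>. Applied to \<phi>\<zeta>, the formula for the square
  gives \<phi>\<zeta> = a\<zeta>, and one more \<phi> gives a\<phi>\<zeta> = 0; either factor being
  zero suffices.\<close>

lemma phi_zeta: "\<phi> p (\<zeta> p) = 0"
proof -
  have 0: "\<phi> p (\<phi> p (\<zeta> p)) = 0" by (simp add: phi_phi)
  define a where "a = \<eta> p (\<phi> p (\<zeta> p))"
  have 1: "\<phi> p (\<zeta> p) = a *\<^sub>R \<zeta> p"
    using phi_phi[of "\<phi> p (\<zeta> p)" p] 0 by (simp add: phi_0 a_def)
  have "a *\<^sub>R \<phi> p (\<zeta> p) = 0"
    using phi_scale[OF zeta_in, of p a] 0 unfolding 1[symmetric] by simp
  then show ?thesis using 1 by auto
qed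

text \<open>The cube of \<phi> is computed in two ways, as \<phi> of its square and as its square of
  \<phi>.\<close>

lemma eta_phi:
  assumes "v \<in> T p" shows "\<eta> p (\<phi> p v) = 0"
proof -
  have "\<phi> p (\<phi> p (\<phi> p v)) = \<phi> p v"
    using assms by (simp add: phi_phi[of v] phi_diff phi_scale phi_zeta)
  then have "\<eta> p (\<phi> p v) *\<^sub>R \<zeta> p = 0"
    using assms phi_phi[of "\<phi> p v" p] by simp
  then show ?thesis using zeta_nonzero by simp
qed

text \<open>Metric compatibility against \<zeta>, where \<phi>\<zeta> = 0 makes the left side
  vanish.\<close>

lemma g_zeta: "v \<in> T p \<Longrightarrow> g p v (\<zeta> p) = \<eta> p v"
  using g_phi_phi[of v p "\<zeta> p"] by (simp add: phi_zeta g_0_right)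

text \<open>Both sides come from g(\<phi>u, \<phi>\<phi>v): once by metric compatibility, once by
  the formula for the square of \<phi>.\<close>

lemma g_phi_skew:
  assumes "u \<in> T p" "v \<in> T p" shows "g p u (\<phi> p v) = - g p (\<phi> p u) v"
proof -
  have "g p (\<phi> p u) (\<phi> p (\<phi> p v)) = - g p u (\<phi> p v)"
    using assms by (simp add: g_phi_phi eta_phi)
  moreover have "g p (\<phi> p u) (\<phi> p (\<phi> p v)) = g p (\<phi> p u) v"
    using assms by (simp add: phi_phi[of v] g_diff_right g_scale_right g_zeta eta_phi)
  ultimately show ?thesis by simp
qed

text \<open>The eigenspace dimensions give \<open>dim T p \<le> 2 n + 1\<close>; since \<open>n > 0\<close> and \<open>dim\<close> is \<open>0\<close> on
  infinite-dimensional spaces, they also give finiteness.\<close>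

lemma tangent_space_finite_span:
  obtains B where "finite B" "T p \<subseteq> span B" "card B \<le> DIM('e)"
proof -
  define P where "P = {v \<in> T p. \<eta> p v = 0 \<and> \<phi> p v = v}"
  define N where "N = {v \<in> T p. \<eta> p v = 0 \<and> \<phi> p v = - v}"
  obtain BP where "P \<subseteq> span BP" "card BP = dim P"
    by (rule basis_exists[of P])
  then have BP: "P \<subseteq> span BP" "card BP = n"
    by (simp_all add: P_def dim_eigenspaces)
  obtain BN where "N \<subseteq> span BN" "card BN = dim N"
    by (rule basis_exists[of N])
  then have BN: "N \<subseteq> span BN" "card BN = n"
    by (simp_all add: N_def dim_eigenspaces)
  define B where "B = insert (\<zeta> p) (BP \<union> BN)"
  have fin: "finite BP" "finite BN"
    using BP(2) BN(2) n_pos by (simp_all add: card_ge_0_finite)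
  have sub: "P \<subseteq> span B" "N \<subseteq> span B" "\<zeta> p \<in> span B"
    using BP(1) BN(1) span_mono[of BP B] span_mono[of BN B] span_base[of "\<zeta> p" B]
    by (auto simp: B_def)
  have "v \<in> span B" if v: "v \<in> T p" for v
  proof -
    define w where "w = v - \<eta> p v *\<^sub>R \<zeta> p"
    have w: "w \<in> T p" "\<eta> p w = 0"
      using v by (simp_all add: w_def eta_diff eta_scale)
    \<comment> \<open>On the kernel of \<eta> the square of \<phi> is the identity, so these are
      eigenvectors; their half sum is \<open>w\<close>.\<close>
    have "w + \<phi> p w \<in> P" "w - \<phi> p w \<in> N"
      using w by (simp_all add: P_def N_def eta_add eta_diff eta_phi phi_add phi_diff phi_phi)
    then have "w + \<phi> p w \<in> span B" "w - \<phi> p w \<in> span B"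
      using sub(1,2) by (simp_all add: subset_iff)
    then have "(1/2) *\<^sub>R ((w + \<phi> p w) + (w - \<phi> p w)) + \<eta> p v *\<^sub>R \<zeta> p \<in> span B"
      by (rule span_add[OF span_scale[OF span_add] span_scale[OF sub(3)]])
    moreover have "(w + \<phi> p w) + (w - \<phi> p w) = w + w"
      by (simp add: fun_eq_iff)
    then have "(1/2) *\<^sub>R ((w + \<phi> p w) + (w - \<phi> p w)) = w"
      by (simp only: scaleR_half_double)
    ultimately show ?thesis by (simp add: w_def)
  qed
  moreover have "card B \<le> DIM('e)"
    using card_insert_le_m1[of "2 * n + 1" "BP \<union> BN" "\<zeta> p"] card_Un_le[of BP BN] BP(2) BN(2)
    by (simp add: B_def dim_eq)
  ultimately show thesis using that[of B] fin by (auto simp: B_def)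
qed

lemma vfield_through:
  assumes "v \<in> T p" shows "\<exists>X\<in>VF. X p = v"
proof -
  obtain B where "finite B" "T p \<subseteq> span B" "card B \<le> DIM('e)"
    by (rule tangent_space_finite_span)
  then show ?thesis using assms by (rule tangent_vector_extends)
qed

text \<open>Justifies the choice in \<open>extension\<close>, so that facts about vector fields
  apply to the curvature inside \<open>ricci\<close>.\<close>

lemma extension_vfield:
  assumes "v \<in> T p" shows "extension A p v \<in> VF"
proof -
  have "\<exists>X. X \<in> VF \<and> X p = v" using vfield_through[OF assms] by (simp add: Bex_def)
  from someI_ex[OF this] show ?thesis by (simp add: extension_def)
qed

section \<open>The Levi-Civita connection and parallelism of \<zeta>\<close>

lemma nabla_vfield [simp]: "X \<in> VF \<Longrightarrow> Y \<in> VF \<Longrightarrow> nabla X Y \<in> VF"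
  and nabla_add_right: "X \<in> VF \<Longrightarrow> Y \<in> VF \<Longrightarrow> Z \<in> VF \<Longrightarrow> nabla X (Y + Z) = nabla X Y + nabla X Z"
  using levi_civita by (simp_all add: levi_civita_def affine_connection_def)

lemma torsion_free: "X \<in> VF \<Longrightarrow> Y \<in> VF \<Longrightarrow> lie_bracket X Y = nabla X Y - nabla Y X"
  and nabla_metric: "X \<in> VF \<Longrightarrow> Y \<in> VF \<Longrightarrow> Z \<in> VF \<Longrightarrow>
    X p (\<lambda>q. g q (Y q) (Z q)) = g p (nabla X Y p) (Z p) + g p (Y p) (nabla X Z p)"
  using levi_civita by (simp_all add: levi_civita_def)

text \<open>Closure under brackets is read off from the torsion-free connection instead of being
  computed with derivations.\<close>

lemma lie_bracket_vfield [simp]: "X \<in> VF \<Longrightarrow> Y \<in> VF \<Longrightarrow> lie_bracket X Y \<in> VF"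
  by (simp add: torsion_free subspace_diff[OF subspace_vfields])

declare vfield_value [simp]

lemma eta_lie_bracket:
  assumes "X \<in> VF" "Y \<in> VF"
  shows "\<eta> p (lie_bracket X Y p) = X p (\<lambda>q. \<eta> q (Y q)) - Y p (\<lambda>q. \<eta> q (X q))"
proof -
  have "d_one_form \<eta> X Y p = 0"
    using para_cosymplectic assms by (simp add: para_cosymplectic_def)
  then show ?thesis by (simp add: d_one_form_def)
qed

text \<open>In the Nijenhuis tensor at (X, \<zeta>) the brackets with \<phi>\<zeta> drop out, which
  leaves \<phi>w = 0 for w = \<phi>[X, \<zeta>] - [\<phi>X, \<zeta>]. A vector killed by both \<phi>
  and \<eta> is zero.\<close>

lemma lie_bracket_zeta_phi:
  assumes X: "X \<in> VF"
  shows "lie_bracket \<zeta> (\<lambda>q. \<phi> q (X q)) p = \<phi> p (lie_bracket \<zeta> X p)"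
proof -
  let ?Y = "\<lambda>q. \<phi> q (X q)"
  note Y = phi_vfield[OF X]
  have zero: "\<phi> q (\<zeta> q) = 0" for q by (rule phi_zeta)
  have "nijenhuis \<phi> X \<zeta> p - (2 * d_one_form \<eta> X \<zeta> p) *\<^sub>R \<zeta> p = 0" "d_one_form \<eta> X \<zeta> p = 0"
    using para_cosymplectic X zeta by (simp_all add: para_cosymplectic_def normal_structure_def)
  then have "nijenhuis \<phi> X \<zeta> p = 0" by simp
  then have 1: "\<phi> p (\<phi> p (lie_bracket X \<zeta> p)) - \<phi> p (lie_bracket ?Y \<zeta> p) = 0"
    by (simp add: nijenhuis_def zero lie_bracket_zero_right[OF X] lie_bracket_zero_right[OF Y] phi_0)
  define w where "w = \<phi> p (lie_bracket X \<zeta> p) - lie_bracket ?Y \<zeta> p"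
  have w: "w \<in> T p" "\<phi> p w = 0"
    using 1 X Y zeta by (simp_all add: w_def phi_diff)
  \<comment> \<open>Since d\<eta> = 0, \<eta> of the bracket involves only derivatives of the
    constants \<eta>(\<zeta>) = 1 and \<eta>(\<phi>X) = 0.\<close>
  have "\<eta> p w = 0"
    using X Y zeta by (simp add: w_def eta_diff eta_phi eta_lie_bracket vfield_const[OF X] vfield_const[OF Y]
        vfield_const[OF zeta])
  then have "w = 0" using phi_phi[OF w(1)] w(2) by (simp add: phi_0)
  then have "lie_bracket ?Y \<zeta> p = \<phi> p (lie_bracket X \<zeta> p)" by (simp add: w_def)
  then show ?thesis
    using X zeta by (simp add: lie_bracket_anticommute[of \<zeta>] phi_minus)
qed

text \<open>Metric compatibility and vanishing torsion cancel the terms with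
  \<open>nabla \<zeta> X\<close> and \<open>nabla \<zeta> Y\<close>.\<close>

lemma lie_derivative_zeta:
  assumes X: "X \<in> VF" and Y: "Y \<in> VF"
  shows "lie_derivative \<zeta> g X Y p = g p (nabla X \<zeta> p) (Y p) + g p (X p) (nabla Y \<zeta> p)"
  using X Y zeta
  by (simp add: lie_derivative_def nabla_metric torsion_free g_diff_left g_diff_right)

text \<open>\<open>d\<Phi>(\<zeta>,X,Y) = 0\<close> says that the flow of \<open>\<zeta>\<close> preserves \<open>\<Phi>\<close>; by normality it also
  preserves \<open>\<phi>\<close>.\<close>

lemma lie_derivative_zeta_phi:
  assumes X: "X \<in> VF" and Y: "Y \<in> VF"
  shows "lie_derivative \<zeta> g X (\<lambda>q. \<phi> q (Y q)) p = 0"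
proof -
  have "d_two_form (fundamental_form \<phi> g) \<zeta> X Y p = 0"
    using para_cosymplectic X Y zeta by (simp add: para_cosymplectic_def)
  \<comment> \<open>The three terms of d\<Phi> with \<zeta> as an argument of \<Phi> vanish.\<close>
  moreover have "g q (Y q) (\<phi> q (\<zeta> q)) = 0" for q
    using Y by (simp add: phi_zeta g_0_right)
  moreover have "g q (\<zeta> q) (\<phi> q (X q)) = 0" for q
    using X by (simp add: g_phi_skew phi_zeta g_0_left)
  moreover have "g p (lie_bracket X Y p) (\<phi> p (\<zeta> p)) = 0"
    using X Y by (simp add: phi_zeta g_0_right)
  \<comment> \<open>The signs from the bracket and from skewness of \<phi> cancel; moving \<phi>
    into the bracket then completes the Lie derivative.\<close>
  moreover have "g p (lie_bracket Y \<zeta> p) (\<phi> p (X p)) = g p (X p) (\<phi> p (lie_bracket \<zeta> Y p))"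
    using X Y zeta
    by (simp add: lie_bracket_anticommute[of Y] g_minus_left g_sym[of "lie_bracket \<zeta> Y p" p]
        g_phi_skew[of "X p" p])
  ultimately show ?thesis
    using X Y zeta
    by (simp add: d_two_form_def fundamental_form_def lie_derivative_def vfield_const lie_bracket_zeta_phi)
qed

text \<open>As \<eta> = g(., \<zeta>), closedness of \<eta> is an identity for derivatives of g(.,
  \<zeta>); expanding it by the connection leaves only the derivatives of \<zeta>.\<close>

lemma nabla_zeta_symmetric:
  assumes X: "X \<in> VF" and Y: "Y \<in> VF"
  shows "g p (nabla X \<zeta> p) (Y p) = g p (X p) (nabla Y \<zeta> p)"
proof -
  have "X p (\<lambda>q. g q (Y q) (\<zeta> q)) - Y p (\<lambda>q. g q (X q) (\<zeta> q)) = g p (lie_bracket X Y p) (\<zeta> p)"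
    using X Y by (simp add: g_zeta eta_lie_bracket)
  then show ?thesis
    using X Y zeta
    by (simp add: nabla_metric torsion_free g_diff_left g_sym[of "Y p" p "nabla X \<zeta> p"])
qed

text \<open>By symmetry the Lie derivative at (X, Z) is twice the pairing of
  \<open>nabla X \<zeta>\<close> with Z, so that pairing vanishes on the image of \<phi>. It
  vanishes on \<zeta> because g(\<zeta>, \<zeta>) = 1. These directions span, and \<open>g\<close>
  is nondegenerate.\<close>

lemma nabla_zeta:
  assumes X: "X \<in> VF" shows "nabla X \<zeta> = 0"
proof
  fix p
  have in_T: "nabla X \<zeta> p \<in> T p" using X zeta by simp
  have phi: "g p (nabla X \<zeta> p) (\<phi> p v) = 0" if v: "v \<in> T p" for v
  proof -
    obtain Y where Y: "Y \<in> VF" "Y p = v" using vfield_through[OF v] by (rule bexE)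
    show ?thesis
      using lie_derivative_zeta_phi[OF X Y(1), of p] lie_derivative_zeta[OF X phi_vfield[OF Y(1)], of p]
        nabla_zeta_symmetric[OF X phi_vfield[OF Y(1)], of p] Y(2) by simp
  qed
  have "X p (\<lambda>q. g q (\<zeta> q) (\<zeta> q)) = 0"
    using X by (simp add: g_zeta vfield_const)
  then have zeta0: "g p (nabla X \<zeta> p) (\<zeta> p) = 0"
    using X zeta by (simp add: nabla_metric g_sym[of "\<zeta> p" p "nabla X \<zeta> p"])
  have "g p (nabla X \<zeta> p) v = 0" if v: "v \<in> T p" for v
  proof -
    have "v = \<phi> p (\<phi> p v) + \<eta> p v *\<^sub>R \<zeta> p" using v by (simp add: phi_phi)
    then have "g p (nabla X \<zeta> p) v = g p (nabla X \<zeta> p) (\<phi> p (\<phi> p v) + \<eta> p v *\<^sub>R \<zeta> p)" by simp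
    also have "\<dots> = 0"
      unfolding g_add_right[OF in_T phi_in[OF phi_in[OF v]] T_scale[OF zeta_in]]
      by (simp add: g_scale_right in_T phi v zeta0)
    finally show ?thesis .
  qed
  then show "nabla X \<zeta> p = 0 p" using g_nondegenerate[OF in_T] by simp
qed

lemma lie_derivative_zeta_metric:
  "X \<in> VF \<Longrightarrow> Y \<in> VF \<Longrightarrow> lie_derivative \<zeta> g X Y p = 0"
  by (simp add: lie_derivative_zeta nabla_zeta g_0_left g_0_right)

section \<open>Curvature applied to \<zeta>\<close>

lemma curvature_zeta:
  assumes "X \<in> VF" "Y \<in> VF" shows "curvature nabla X Y \<zeta> = 0"
proof -
  have "nabla Z 0 = 0" if "Z \<in> VF" for Z
    using nabla_add_right[OF that subspace_0[OF subspace_vfields] subspace_0[OF subspace_vfields]] by simp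
  then show ?thesis using assms zeta by (simp add: curvature_def nabla_zeta)
qed

text \<open>With \<zeta> in the second slot, the endomorphism under the trace is R(., Y)\<zeta>,
  which is zero on every tangent vector.\<close>

lemma ricci_zeta: "Y \<in> VF \<Longrightarrow> ricci A nabla Y \<zeta> p = 0"
  unfolding ricci_def by (rule trace_on_eq_0) (simp add: curvature_zeta extension_vfield)

end

theorem theorem7p1:
  fixes A :: "('a::{t2_space,second_countable_topology}, 'e::euclidean_space) chart set"
    and n :: nat
    and \<phi> :: "'a \<Rightarrow> 'a tvec \<Rightarrow> 'a tvec"
    and \<zeta> :: "'a vfield"
    and \<eta> :: "'a \<Rightarrow> 'a tvec \<Rightarrow> real"
    and g :: "'a \<Rightarrow> 'a tvec \<Rightarrow> 'a tvec \<Rightarrow> real"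
    and nabla :: "'a vfield \<Rightarrow> 'a vfield \<Rightarrow> 'a vfield"
    and h lam :: "'a \<Rightarrow> real"
    and \<alpha> \<beta> :: real
  assumes "n \<ge> 1"
    and "para_cosymplectic A n \<phi> \<zeta> \<eta> g"
    and "levi_civita A g nabla"
    and "proper_h_almost_ricci_yamabe_soliton A nabla h g \<zeta> lam \<alpha> \<beta>"
  shows "einstein A g nabla"
proof -
  interpret para_cosymplectic_manifold A n \<phi> \<zeta> \<eta> g nabla
    using assms(1-3) by unfold_locales
  have soliton: "\<alpha> * ricci A nabla X Y p
      + (lam p - \<beta> / 2 * scalar_curvature A g nabla p) * g p (X p) (Y p) = 0"
    if "X \<in> vfields A" "Y \<in> vfields A" for X Y p
  proof -
    have "\<forall>X\<in>vfields A. \<forall>Y\<in>vfields A. \<forall>p.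
        h p / 2 * lie_derivative \<zeta> g X Y p + \<alpha> * ricci A nabla X Y p
        + (lam p - \<beta> / 2 * scalar_curvature A g nabla p) * g p (X p) (Y p) = 0"
      using assms(4)
      unfolding proper_h_almost_ricci_yamabe_soliton_def h_almost_ricci_yamabe_soliton_def
      by (elim conjE)
    then have "h p / 2 * lie_derivative \<zeta> g X Y p + \<alpha> * ricci A nabla X Y p
        + (lam p - \<beta> / 2 * scalar_curvature A g nabla p) * g p (X p) (Y p) = 0"
      using that by blast
    then show ?thesis by (simp add: lie_derivative_zeta_metric that)
  qed
  have "\<alpha> \<noteq> 0"
    using assms(4) by (simp add: proper_h_almost_ricci_yamabe_soliton_def)
  \<comment> \<open>At (\<zeta>, \<zeta>) the Ricci term is 0 and the metric is 1, so the equation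
    isolates this coefficient.\<close>
  have factor: "lam p - \<beta> / 2 * scalar_curvature A g nabla p = 0" for p
    using soliton[OF zeta zeta, of p] by (simp add: ricci_zeta[OF zeta] g_zeta)
  have "ricci A nabla X Y p = 0" if "X \<in> vfields A" "Y \<in> vfields A" for X Y p
    using soliton[OF that, of p] \<open>\<alpha> \<noteq> 0\<close> unfolding factor by simp
  \<comment> \<open>The manifold is Ricci-flat, so the Einstein constant is 0.\<close>
  then show ?thesis unfolding einstein_def by (intro exI[of _ 0]) simp
qed

end
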